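(* Let $\mathcal{D}_1 = \{ k \geq 1 : \varphi_1(n) \mid \varphi_k(n) \text{ for all integers } n \geq 1 \}$, where $k$ ranges over integers. Then $\mathcal{D}_1 \subseteq \{1, 3, 15\}$.
   Context: For integers $k \geq 0$ and $n \geq 1$, define $$\varphi_k(n) = \sum_{\substack{1 \leq a \leq n \\ \gcd(a,n) = 1}} a^k,$$ the sum being over integers $a$; thus $\varphi_0$ is Euler's totient function. Divisibility is divisibility of integers. *)

theory Defs
  imports "HOL-Number_Theory.Number_Theory"
begin

definition phi :: "nat \<Rightarrow> nat \<Rightarrow> nat" where
  "phi k n = (\<Sum>a | 1 \<le> a \<and> a \<le> n \<and> gcd a n = 1. a ^ k)"

definition D1 :: "nat set" where
  "D1 = {k. k \<ge> 1 \<and> (\<forall>n\<ge>1. phi 1 n dvd phi k n)}"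

end

theory Submission
  imports Defs
begin

text \<open>
  Let \<open>q\<close> be an odd prime and let \<open>n\<close> be a product of \<open>r \<ge> 1\<close> distinct primes congruent to 1 modulo a
  high power of \<open>q\<close>. Faulhaber's formula and inclusion-exclusion give
  \<open>phi k n = (\<Sum>j. s\<^sub>j n^(k+1-j) (\<Prod>p dvd n. 1 - p^(j-1)))\<close> with \<open>s\<^sub>j = C(k+1,j) B\<^sub>j / (k+1)\<close>, and
  \<open>(1 - p^(j-1)) / (1 - 1/p)\<close> is \<open>q\<close>-adically close to \<open>1 - j\<close>. Hence \<open>k \<in> D1\<close> forces
  \<open>\<Sum>j. s\<^sub>j (1 - j)^r\<close> to be \<open>q\<close>-integral for every \<open>r \<ge> 1\<close>, and so is \<open>\<Sum>j. s\<^sub>j F(j)\<close> for every integer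
  polynomial \<open>F\<close> vanishing at 1. Taking \<open>F(j) = j(j-1)\<dots>(j-c)\<close> with \<open>1 \<le> c \<le> k mod q\<close> and using
  \<open>q B\<^sub>j \<equiv> \<Sum>g<q. g^j\<close> modulo \<open>q\<close>, one finds that \<open>q\<close> divides \<open>\<Sum>g<q. g^(c+1) ((g+1)^(k-c) - g^(k-c))\<close>.
  By Fermat this fails for \<open>c = k mod (q-1)\<close>, so that \<open>k mod q < k mod (q-1)\<close> for every odd prime
  \<open>q \<le> k + 1\<close>.

  Consequently \<open>k + 1\<close> has no odd prime factor and \<open>k + 2\<close> has no odd prime factor except possibly itself;
  thus \<open>k + 1 = 2^(2^i)\<close>. For odd \<open>i \<ge> 3\<close> the prime 13 gives a contradiction, for even \<open>i \<ge> 4\<close> the prime 241.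
\<close>

section \<open>Rationals integral at a prime, and Bernoulli numbers\<close>

text \<open>The ring of \<open>q\<close>-integral rationals, for prime \<open>q\<close>.\<close>

definition loc :: "nat \<Rightarrow> rat set" where
  "loc q = {x. \<exists>b::int. \<not> int q dvd b \<and> of_int b * x \<in> \<int>}"

lemma loc_cancel:
  assumes "prime q" "\<not> int q dvd b" "of_int b * x \<in> loc q"
  shows "x \<in> loc q"
proof -
  obtain c :: int where c: "\<not> int q dvd c" "of_int c * (of_int b * x) \<in> \<int>"
    using assms(3) by (auto simp: loc_def)
  have "\<not> int q dvd c * b" using c assms by (simp add: prime_dvd_mult_iff)
  moreover have "of_int (c * b) * x \<in> \<int>" using c(2) by (simp add: mult.assoc)
  ultimately show ?thesis unfolding loc_def by blast
qed

lemma loc_Ints: "x \<in> \<int> \<Longrightarrow> prime q \<Longrightarrow> x \<in> loc q"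
  unfolding loc_def by (auto intro!: exI[of _ 1] dest: prime_gt_1_nat)

lemma loc_of_int [simp]: "prime q \<Longrightarrow> of_int a \<in> loc q"
  and loc_of_nat [simp]: "prime q \<Longrightarrow> of_nat m \<in> loc q"
  by (auto intro: loc_Ints)

lemma loc_add:
  assumes "prime q" "x \<in> loc q" "y \<in> loc q"
  shows "x + y \<in> loc q"
proof -
  obtain b c :: int where b: "\<not> int q dvd b" "of_int b * x \<in> \<int>"
    and c: "\<not> int q dvd c" "of_int c * y \<in> \<int>"
    using assms by (auto simp: loc_def)
  have "of_int c * (of_int b * x) + of_int b * (of_int c * y) \<in> \<int>"
    by (intro Ints_add Ints_mult b c Ints_of_int)
  then have "of_int (b * c) * (x + y) \<in> \<int>" by (simp add: algebra_simps)
  moreover have "\<not> int q dvd b * c" using b c assms by (simp add: prime_dvd_mult_iff)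
  ultimately show ?thesis unfolding loc_def by blast
qed

lemma loc_mult:
  assumes "prime q" "x \<in> loc q" "y \<in> loc q"
  shows "x * y \<in> loc q"
proof -
  obtain b c :: int where b: "\<not> int q dvd b" "of_int b * x \<in> \<int>"
    and c: "\<not> int q dvd c" "of_int c * y \<in> \<int>"
    using assms by (auto simp: loc_def)
  have "(of_int b * x) * (of_int c * y) \<in> \<int>"
    by (intro Ints_mult b c)
  then have "of_int (b * c) * (x * y) \<in> \<int>" by (simp add: algebra_simps)
  moreover have "\<not> int q dvd b * c" using b c assms by (simp add: prime_dvd_mult_iff)
  ultimately show ?thesis unfolding loc_def by blast
qed

lemma loc_diff: "prime q \<Longrightarrow> x \<in> loc q \<Longrightarrow> y \<in> loc q \<Longrightarrow> x - y \<in> loc q"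
  using loc_add[of q x "of_int (-1) * y"] loc_mult[of q "of_int (-1)" y] loc_of_int[of q "-1"] by simp

lemma loc_sum:
  assumes "prime q" "\<And>i. i \<in> A \<Longrightarrow> f i \<in> loc q"
  shows "sum f A \<in> loc q"
  using assms by (induction A rule: infinite_finite_induct) (auto intro: loc_add loc_Ints)

text \<open>The way back from integrality to divisibility: a denominator prime to \<open>q\<close>
  cannot cancel the \<open>q\<close> below \<open>z\<close>.\<close>

lemma loc_div_dvd:
  assumes "prime q" "of_int z / of_nat q \<in> loc q"
  shows "int q dvd z"
proof -
  have q: "q > 0" using assms by (simp add: prime_gt_0_nat)
  obtain b m :: int where b: "\<not> int q dvd b" "of_int b * (of_int z / of_nat q) = (of_int m :: rat)"
    using assms by (auto simp: loc_def elim: Ints_cases)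
  have "(of_int (b * z) :: rat) = of_int (m * int q)" using b(2) q by (simp add: field_simps)
  then have "b * z = m * int q" using of_int_eq_iff by blast
  then show ?thesis using b(1) assms(1)
    by (metis dvd_triv_right prime_dvd_mult_iff prime_nat_int_transfer)
qed

lemma loc_denom:
  assumes "prime q"
  shows "\<exists>N. of_nat q ^ N * x \<in> loc q"
proof -
  obtain a b :: int where x: "x = of_int a / of_int b" and "b > 0"
    by (metis quotient_of_denom_pos quotient_of_div surj_pair)
  define v where "v = multiplicity (int q) b"
  have "\<not> is_unit (int q)" using assms prime_gt_1_nat by fastforce
  then obtain u where u: "b = int q ^ v * u" "\<not> int q dvd u"
    using \<open>b > 0\<close> multiplicity_decompose'[of b "int q"] unfolding v_def by blast
  have q: "q > 0" using assms by (simp add: prime_gt_0_nat)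
  have "of_int u * (of_nat q ^ v * x) = of_int a"
    using \<open>b > 0\<close> q u(2) unfolding x u(1) by (cases "u = 0") (auto simp: field_simps)
  then have "of_nat q ^ v * x \<in> loc q" unfolding loc_def using u(2) by auto
  then show ?thesis by blast
qed

text \<open>A single exponent \<open>N\<close> clears the \<open>q\<close>-part of finitely many
  denominators; \<open>q ^ N\<close> will later be the modulus to which primes must be congruent to
  1.\<close>

lemma loc_denom_uniform:
  fixes n :: nat
  assumes q: "prime q"
  shows "\<exists>N. \<forall>j<n. of_nat q ^ N * f j \<in> loc q"
proof (induction n)
  case (Suc n)
  then obtain N where N: "\<And>j. j < n \<Longrightarrow> of_nat q ^ N * f j \<in> loc q" by blast
  obtain M where M: "of_nat q ^ M * f n \<in> loc q" using loc_denom[OF q] by blast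
  have "of_nat q ^ (N + M) * f j \<in> loc q" if "j < Suc n" for j
  proof (cases "j = n")
    case True
    then show ?thesis using loc_mult[OF q loc_of_nat[OF q] M, of "q ^ N"] by (simp add: power_add mult.assoc)
  next
    case False
    then show ?thesis using loc_mult[OF q loc_of_nat[OF q] N[of j], of "q ^ M"] that
      by (simp add: power_add algebra_simps)
  qed
  then show ?case by blast
qed simp

text \<open>If \<open>q ^ e\<close> divided \<open>e + 1\<close>, then
  \<open>3 ^ e \<le> q ^ e \<le> e + 1\<close>, which is impossible for \<open>e \<ge> 1\<close>. So
  the \<open>q\<close>-part of \<open>e + 1\<close> divides \<open>q ^ (e - 1)\<close>. For
  \<open>q = 2\<close> and \<open>e = 1\<close> this breaks down.\<close>

lemma power_div_Suc_loc:
  assumes "prime q" "odd q" "e \<ge> 1"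
  shows "of_nat q ^ (e - 1) / of_nat (Suc e) \<in> loc q"
proof -
  have q: "q \<ge> 3" using assms prime_ge_2_nat[of q] by (cases "q = 2") auto
  define v where "v = multiplicity q (Suc e)"
  have "\<not> is_unit q" using q by simp
  then obtain u where u: "Suc e = q ^ v * u" "\<not> q dvd u"
    using multiplicity_decompose'[of "Suc e" q] unfolding v_def by blast
  have ve: "v \<le> e - 1"
  proof (rule ccontr)
    assume "\<not> v \<le> e - 1"
    then have "q ^ e \<le> q ^ v" using q by (intro power_increasing) auto
    also have "q ^ v \<le> Suc e" using u by (metis dvd_imp_le dvd_triv_left zero_less_Suc)
    finally have "q ^ e \<le> Suc e" .
    moreover have "3 ^ e \<le> q ^ e" using q by (rule power_mono) simp
    moreover have "Suc (Suc d) < 3 ^ Suc d" for d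
      by (induction d) auto
    then have "Suc e < 3 ^ e" using assms(3) by (metis One_nat_def Suc_le_D)
    ultimately show False by linarith
  qed
  have "of_nat q ^ (e - 1) / of_nat (Suc e) = (of_nat q ^ (e - 1 - v) / of_nat u :: rat)"
    using u ve q unfolding u(1)
    by (subst le_add_diff_inverse[OF ve, symmetric], subst power_add) (auto simp: field_simps)
  then have "of_int (int u) * (of_nat q ^ (e - 1) / of_nat (Suc e)) = (of_nat (q ^ (e - 1 - v)) :: rat)"
    using u(2) by (cases "u = 0") auto
  then show ?thesis using loc_cancel[of q "int u"] u(2) assms(1) loc_of_nat
    by (metis int_dvd_int_iff)
qed

section \<open>Bernoulli numbers, Faulhaber's formula and a von Staudt congruence\<close>

text \<open>The convention is \<open>bernoulli 1 = -1/2\<close>, which fits power sums over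
  \<open>a < m\<close>, without the endpoint \<open>m\<close>.\<close>

fun bernoulli :: "nat \<Rightarrow> rat" where
  "bernoulli 0 = 1"
| "bernoulli (Suc n) = - (\<Sum>j\<le>n. of_nat (Suc (Suc n) choose j) * bernoulli j) / of_nat (Suc (Suc n))"

declare bernoulli.simps(2) [simp del]

text \<open>For \<open>m \<ge> 2\<close> the terms below \<open>m\<close> cancel by the recursion.
  The exception at \<open>m = 1\<close> is the source of the right-hand side in
  \<open>bernpoly_diff\<close>.\<close>

lemma bernoulli_sum:
  "(\<Sum>j\<le>m. of_nat (m choose j) * bernoulli j) = bernoulli m + (if m = 1 then 1 else 0)"
proof -
  consider "m = 0" | "m = 1" | n where "m = Suc (Suc n)" by (metis One_nat_def not0_implies_Suc)
  then show ?thesis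
  proof cases
    case 3
    have "(\<Sum>j\<le>Suc n. of_nat (m choose j) * bernoulli j) = 0"
      unfolding 3 by (simp add: bernoulli.simps(2)[of n] field_simps del: binomial_Suc_Suc of_nat_Suc)
    then show ?thesis using 3 by simp
  qed simp_all
qed

definition bernpoly :: "nat \<Rightarrow> rat \<Rightarrow> rat" where
  "bernpoly n x = (\<Sum>j\<le>n. of_nat (n choose j) * bernoulli j * x ^ (n - j))"

text \<open>Expand \<open>(x + 1) ^ (n - j)\<close> and collect powers of \<open>x\<close>. By
  \<open>bernoulli_sum\<close> the coefficient of \<open>x ^ i\<close> is the old one, except for an
  extra \<open>n\<close> at \<open>i = n - 1\<close>.\<close>

lemma bernpoly_diff: "bernpoly n (x + 1) - bernpoly n x = of_nat n * x ^ (n - 1)"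
proof -
  have "bernpoly n (x + 1) = (\<Sum>j\<le>n. \<Sum>i\<le>n-j. of_nat (n choose j) * of_nat ((n - j) choose i) * bernoulli j * x ^ i)"
    unfolding bernpoly_def binomial_ring by (simp add: sum_distrib_left mult_ac)
  also have "\<dots> = (\<Sum>(j,i)\<in>(SIGMA j:{..n}. {..n-j}). of_nat (n choose j) * of_nat ((n - j) choose i) * bernoulli j * x ^ i)"
    by (rule sum.Sigma) auto
  also have "\<dots> = (\<Sum>(i,j)\<in>(SIGMA i:{..n}. {..n-i}). of_nat (n choose i) * x ^ i * (of_nat ((n - i) choose j) * bernoulli j))"
  proof (rule sum.reindex_bij_witness[of _ prod.swap prod.swap])
    fix z assume "z \<in> (SIGMA j:{..n}. {..n - j})"
    then obtain i j where z: "z = (i, j)" "i \<le> n" "j \<le> n - i" by auto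
    \<comment> \<open>Both sides count the ordered pairs of disjoint subsets of sizes
      \<open>i\<close> and \<open>j\<close> in an \<open>n\<close>-element set.\<close>
    then have "(n choose i) * ((n - i) choose j) = (n choose j) * ((n - j) choose i)"
      using choose_mult[of i "i + j" n] choose_mult[of j "i + j" n] binomial_symmetric[of j "i+j"]
      by simp
    then have "of_nat (n choose i) * of_nat ((n - i) choose j) = (of_nat (n choose j) * of_nat ((n - j) choose i) :: rat)"
      by (metis of_nat_mult)
    then show "(case prod.swap z of (i, j) \<Rightarrow> of_nat (n choose i) * x ^ i * (of_nat ((n - i) choose j) * bernoulli j)) =
        (case z of (j, i) \<Rightarrow> of_nat (n choose j) * of_nat ((n - j) choose i) * bernoulli j * x ^ i)"
      using z(1) by (simp add: mult_ac)
  qed auto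
  also have "\<dots> = (\<Sum>i\<le>n. of_nat (n choose i) * x ^ i * (\<Sum>j\<le>n-i. of_nat ((n - i) choose j) * bernoulli j))"
    by (subst sum.Sigma[symmetric]) (auto simp: sum_distrib_left)
  also have "\<dots> = (\<Sum>i\<le>n. of_nat (n choose i) * x ^ i * bernoulli (n - i)) +
      (\<Sum>i\<le>n. if n - i = 1 then of_nat (n choose i) * x ^ i else 0)"
    unfolding bernoulli_sum sum.distrib[symmetric] by (rule sum.cong) (auto simp: algebra_simps)
  also have "(\<Sum>i\<le>n. of_nat (n choose i) * x ^ i * bernoulli (n - i)) = bernpoly n x"
    unfolding bernpoly_def
    by (rule sum.reindex_bij_witness[of _ "\<lambda>i. n - i" "\<lambda>i. n - i"]) (auto simp: binomial_symmetric[symmetric])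
  also have "(\<Sum>i\<le>n. if n - i = 1 then of_nat (n choose i) * x ^ i else 0) = of_nat n * x ^ (n - 1)"
  proof (cases n)
    case (Suc m)
    then have "(\<Sum>i\<le>n. if n - i = 1 then of_nat (n choose i) * x ^ i else 0) =
        (\<Sum>i\<le>n. if i = m then of_nat (n choose i) * x ^ i else 0)"
      by (intro sum.cong) auto
    then show ?thesis using Suc by (simp add: sum.delta)
  qed simp
  finally show ?thesis by simp
qed

text \<open>The coefficients \<open>s\<^sub>j\<close> of Faulhaber's formula.\<close>

definition psum_coeff :: "nat \<Rightarrow> nat \<Rightarrow> rat" where
  "psum_coeff k j = of_nat (Suc k choose j) * bernoulli j / of_nat (Suc k)"

lemma power_sum:
  "(\<Sum>a<m. of_nat a ^ k) = (\<Sum>j\<le>k. psum_coeff k j * of_nat m ^ (Suc k - j))"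
proof -
  have "of_nat (Suc k) * (\<Sum>a<m. of_nat a ^ k) = bernpoly (Suc k) (of_nat m) - bernpoly (Suc k) 0"
  proof (induction m)
    case (Suc m)
    then show ?case using bernpoly_diff[of "Suc k" "of_nat m"] by (simp add: algebra_simps)
  qed simp
  also have "bernpoly (Suc k) (of_nat m) = (\<Sum>j\<le>k. of_nat (Suc k choose j) * bernoulli j * of_nat m ^ (Suc k - j)) + bernoulli (Suc k)"
    unfolding bernpoly_def by (simp del: binomial_Suc_Suc)
  also have "bernpoly (Suc k) 0 = bernoulli (Suc k)"
    unfolding bernpoly_def by (simp add: Suc_diff_le del: binomial_Suc_Suc)
  also have "(\<Sum>j\<le>k. of_nat (Suc k choose j) * bernoulli j * of_nat m ^ (Suc k - j))
     = of_nat (Suc k) * (\<Sum>j\<le>k. psum_coeff k j * of_nat m ^ (Suc k - j))"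
    unfolding sum_distrib_left psum_coeff_def by (intro sum.cong) (auto simp: field_simps simp del: binomial_Suc_Suc of_nat_Suc)
  finally show ?thesis by (simp del: of_nat_Suc)
qed

text \<open>Faulhaber's formula with upper bound \<open>q\<close>, divided by \<open>q\<close>, has
  \<open>bernoulli m\<close> as its term \<open>j = m\<close>. The terms \<open>j < m\<close> are
  integral: by induction \<open>q * bernoulli j\<close> is, and the remaining power of
  \<open>q\<close> absorbs the denominator by \<open>power_div_Suc_loc\<close>.\<close>

lemma bernoulli_cong_power_sum:
  assumes q: "prime q" "odd q"
  shows "bernoulli m - (\<Sum>g<q. of_nat g ^ m) / of_nat q \<in> loc q"
proof (induction m rule: less_induct)
  case (less m)
  have q0: "(of_nat q :: rat) \<noteq> 0" using q by auto
  have int: "of_nat q * bernoulli j \<in> loc q" if "j < m" for j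
  proof -
    have "of_nat q * (bernoulli j - (\<Sum>g<q. of_nat g ^ j) / of_nat q) + of_nat (\<Sum>g<q. g ^ j) \<in> loc q"
      by (intro loc_add loc_mult q less loc_of_nat that)
    then show ?thesis using q0 by (simp add: algebra_simps)
  qed
  have "(\<Sum>g<q. of_nat g ^ m) = (\<Sum>j<m. psum_coeff m j * of_nat q ^ (Suc m - j)) + psum_coeff m m * of_nat q"
    unfolding power_sum[of m q] by (simp flip: lessThan_Suc_atMost)
  also have "psum_coeff m m = bernoulli m"
    unfolding psum_coeff_def by (simp add: field_simps)
  finally have "bernoulli m - (\<Sum>g<q. of_nat g ^ m) / of_nat q = 0 - (\<Sum>j<m. psum_coeff m j * of_nat q ^ (m - j))"
    using q0 by (simp add: field_simps sum_distrib_left Suc_diff_le)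
  also have "\<dots> \<in> loc q"
  proof (intro loc_diff loc_sum q)
    fix j assume "j \<in> {..<m}"
    then have j: "j < m" by simp
    \<comment> \<open>Trading the denominator \<open>m + 1\<close> for
      \<open>m + 1 - j = e + 1\<close> matches it with the power \<open>q ^ e\<close>, of which one
      factor \<open>q\<close> goes to \<open>bernoulli j\<close>.\<close>
    have c: "of_nat (Suc m choose j) / of_nat (Suc m) = (of_nat (m choose j) / of_nat (Suc m - j) :: rat)"
    proof -
      have "(Suc m - j) * (Suc m choose j) = Suc m * (m choose j)"
        using binomial_absorb_comp[of "Suc m" j] by simp
      then have "(of_nat (Suc m - j) * of_nat (Suc m choose j) :: rat) = of_nat (Suc m) * of_nat (m choose j)"
        by (metis of_nat_mult)
      then show ?thesis using j by (simp add: frac_eq_eq mult.commute del: of_nat_Suc of_nat_diff binomial_Suc_Suc)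
    qed
    define e where "e = m - j"
    have e: "e \<ge> 1" "Suc m - j = Suc e" "of_nat q ^ (m - j) = (of_nat q * of_nat q ^ (e - 1) :: rat)"
      using j unfolding e_def by (simp_all add: Suc_diff_le Suc_diff_Suc flip: power_Suc)
    have "of_nat (m choose j) * (of_nat q * bernoulli j) * (of_nat q ^ (e - 1) / of_nat (Suc e)) \<in> loc q"
      by (intro loc_mult q loc_of_nat int j power_div_Suc_loc e)
    also have "of_nat (m choose j) * (of_nat q * bernoulli j) * (of_nat q ^ (e - 1) / of_nat (Suc e)) =
        of_nat (m choose j) / of_nat (Suc m - j) * bernoulli j * of_nat q ^ (m - j)"
      unfolding e by simp
    also have "\<dots> = psum_coeff m j * of_nat q ^ (m - j)"
      unfolding psum_coeff_def c[symmetric] by simp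
    finally show "psum_coeff m j * of_nat q ^ (m - j) \<in> loc q" .
  qed (use loc_Ints q in auto)
  finally show ?case .
qed

section \<open>Power sums over integers coprime to a set of primes\<close>

text \<open>The bound \<open>m\<close> is kept independent of the set \<open>A\<close> so that
  inclusion-exclusion can be an induction on \<open>A\<close>.\<close>

definition coprime_power_sum :: "nat \<Rightarrow> nat set \<Rightarrow> nat \<Rightarrow> nat" where
  "coprime_power_sum k A m = (\<Sum>a | a < m \<and> (\<forall>p\<in>A. \<not> p dvd a). a ^ k)"

text \<open>The excluded multiples of \<open>p\<close> are \<open>p * b\<close> with
  \<open>b < m\<close>, and the factor \<open>p\<close> does not affect divisibility by the other
  primes in \<open>A\<close>.\<close>

lemma coprime_power_sum_insert:
  assumes "prime p" "p \<notin> A" "\<And>p. p \<in> A \<Longrightarrow> prime p"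
  shows "coprime_power_sum k A (p * m) = coprime_power_sum k (insert p A) (p * m) + p ^ k * coprime_power_sum k A m"
proof -
  let ?S = "{a. a < p * m \<and> (\<forall>r\<in>A. \<not> r dvd a)}"
  let ?T = "{b. b < m \<and> (\<forall>r\<in>A. \<not> r dvd b)}"
  have p0: "p > 0" using assms(1) by (simp add: prime_gt_0_nat)
  have dvd: "r dvd p * b \<longleftrightarrow> r dvd b" if "r \<in> A" for r b
    using assms that by (metis prime_dvd_mult_iff primes_dvd_imp_eq)
  have "{a \<in> ?S. p dvd a} = (\<lambda>b. p * b) ` ?T"
  proof (intro equalityI subsetI)
    fix a assume "a \<in> {a \<in> ?S. p dvd a}"
    then obtain b where b: "a = p * b" "p * b < p * m" "\<forall>r\<in>A. \<not> r dvd p * b" by (auto elim!: dvdE)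
    then show "a \<in> (\<lambda>b. p * b) ` ?T" using dvd by auto
  next
    fix a assume "a \<in> (\<lambda>b. p * b) ` ?T"
    then show "a \<in> {a \<in> ?S. p dvd a}" using dvd p0 by auto
  qed
  then have "(\<Sum>a\<in>{a \<in> ?S. p dvd a}. a ^ k) = p ^ k * coprime_power_sum k A m"
    unfolding coprime_power_sum_def using p0
    by (simp add: sum.reindex inj_on_def sum_distrib_left power_mult_distrib)
  moreover have "{a \<in> ?S. \<not> p dvd a} = {a. a < p * m \<and> (\<forall>r\<in>insert p A. \<not> r dvd a)}" by auto
  moreover have "sum (\<lambda>a. a ^ k) ?S = (\<Sum>a\<in>{a \<in> ?S. \<not> p dvd a}. a ^ k) + (\<Sum>a\<in>{a \<in> ?S. p dvd a}. a ^ k)"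
    by (subst sum.union_disjoint[symmetric]) (auto intro!: sum.cong)
  ultimately show ?thesis unfolding coprime_power_sum_def by simp
qed

text \<open>Removing the multiples of \<open>p\<close> subtracts
  \<open>p ^ k * (m / p) ^ (k + 1 - j)\<close> from \<open>m ^ (k + 1 - j)\<close>, that is,
  multiplies it by \<open>1 - p ^ (j - 1)\<close>. The quotient \<open>p ^ j / p\<close> gives this
  the right meaning at \<open>j = 0\<close>.\<close>

lemma coprime_power_sum_formula:
  assumes "finite A" "\<And>p. p \<in> A \<Longrightarrow> prime p" "\<Prod>A dvd m"
  shows "of_nat (coprime_power_sum k A m) =
    (\<Sum>j\<le>k. psum_coeff k j * of_nat m ^ (Suc k - j) * (\<Prod>p\<in>A. 1 - of_nat p ^ j / of_nat p))"
  using assms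
proof (induction A arbitrary: m rule: finite_induct)
  case empty
  have "of_nat (coprime_power_sum k {} m) = (\<Sum>a<m. of_nat a ^ k :: rat)"
    by (simp add: coprime_power_sum_def lessThan_def)
  then show ?case by (simp add: power_sum)
next
  case (insert p A)
  have pr: "prime p" "\<And>p. p \<in> A \<Longrightarrow> prime p" using insert.prems by auto
  then have p0: "p > 0" by (simp add: prime_gt_0_nat)
  have "p * \<Prod>A dvd m" using insert by simp
  then obtain t where "m = p * \<Prod>A * t" by (elim dvdE)
  then have "m = p * (\<Prod>A * t)" by (simp add: mult.assoc)
  then obtain m' where m: "m = p * m'" "\<Prod>A dvd m'" by (metis dvd_triv_left)
  then have "\<Prod>A dvd m" by simp
  have IH: "of_nat (coprime_power_sum k A m) =
      (\<Sum>j\<le>k. psum_coeff k j * of_nat m ^ (Suc k - j) * (\<Prod>p\<in>A. 1 - of_nat p ^ j / of_nat p))"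
    if "\<Prod>A dvd m" for m
    using insert.IH insert.prems that by simp
  have "of_nat (coprime_power_sum k (insert p A) m) =
      (of_nat (coprime_power_sum k A m) - of_nat p ^ k * of_nat (coprime_power_sum k A m') :: rat)"
    using coprime_power_sum_insert[OF pr(1) insert.hyps(2) pr(2), of k m'] unfolding m(1) by simp
  also have "\<dots> = (\<Sum>j\<le>k. psum_coeff k j * (of_nat m ^ (Suc k - j) - of_nat p ^ k * of_nat m' ^ (Suc k - j)) *
      (\<Prod>p\<in>A. 1 - of_nat p ^ j / of_nat p))"
    unfolding IH[OF \<open>\<Prod>A dvd m\<close>] IH[OF m(2)] by (simp add: sum_distrib_left algebra_simps flip: sum_subtractf)
  also have "\<dots> = (\<Sum>j\<le>k. psum_coeff k j * of_nat m ^ (Suc k - j) * (\<Prod>p\<in>insert p A. 1 - of_nat p ^ j / of_nat p))"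
  proof (rule sum.cong)
    fix j assume "j \<in> {..k}"
    then have "of_nat p ^ Suc k = (of_nat p ^ (Suc k - j) * of_nat p ^ j :: rat)"
      by (simp flip: power_add)
    then have "of_nat m ^ (Suc k - j) - of_nat p ^ k * of_nat m' ^ (Suc k - j) =
        (of_nat m ^ (Suc k - j) * (1 - of_nat p ^ j / of_nat p) :: rat)"
      using p0 unfolding m(1) by (simp add: power_mult_distrib field_simps)
    then show "psum_coeff k j * (of_nat m ^ (Suc k - j) - of_nat p ^ k * of_nat m' ^ (Suc k - j)) *
      (\<Prod>p\<in>A. 1 - of_nat p ^ j / of_nat p) =
      psum_coeff k j * of_nat m ^ (Suc k - j) * (\<Prod>p\<in>insert p A. 1 - of_nat p ^ j / of_nat p)"
      using insert.hyps by (simp add: mult_ac)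
  qed simp
  finally show ?case .
qed

text \<open>The ranges \<open>1..n\<close> and \<open>0..n-1\<close> differ only in \<open>0\<close>
  and \<open>n\<close>, both of which are divisible by any prime in the nonempty
  \<open>A\<close>.\<close>

lemma phi_prod_primes:
  assumes "finite A" "A \<noteq> {}" "\<And>p. p \<in> A \<Longrightarrow> prime p"
  shows "phi k (\<Prod>A) = coprime_power_sum k A (\<Prod>A)"
proof -
  obtain p where p: "p \<in> A" using assms by blast
  have pn: "p dvd \<Prod>A" using dvd_prodI[OF assms(1) p, of id] by simp
  have "coprime a (\<Prod>A) \<longleftrightarrow> (\<forall>p\<in>A. \<not> p dvd a)" for a
  proof
    assume c: "coprime a (\<Prod>A)"
    show "\<forall>p\<in>A. \<not> p dvd a"
    proof
      fix r assume r: "r \<in> A"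
      then have "r dvd \<Prod>A" using dvd_prodI[OF assms(1) r, of id] by simp
      then show "\<not> r dvd a" using c assms(3)[OF r] coprime_common_divisor not_prime_unit by blast
    qed
  next
    assume "\<forall>p\<in>A. \<not> p dvd a"
    then show "coprime a (\<Prod>A)"
      by (intro prod_coprime_right) (use assms(3) prime_imp_coprime_nat coprime_commute in blast)
  qed
  moreover have "a < \<Prod>A" if "a \<le> \<Prod>A" "\<not> p dvd a" for a
    using that pn by (cases "a = \<Prod>A") auto
  moreover have "a \<ge> 1" if "\<not> p dvd a" for a
    using that by (cases a) auto
  ultimately have "1 \<le> a \<and> a \<le> \<Prod>A \<and> gcd a (\<Prod>A) = 1 \<longleftrightarrow> a < \<Prod>A \<and> (\<forall>p\<in>A. \<not> p dvd a)" for a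
    unfolding coprime_iff_gcd_eq_1[symmetric] using p by (metis less_imp_le)
  then have "{a. 1 \<le> a \<and> a \<le> \<Prod>A \<and> gcd a (\<Prod>A) = 1} = {a. a < \<Prod>A \<and> (\<forall>p\<in>A. \<not> p dvd a)}"
    by presburger
  then show ?thesis unfolding phi_def coprime_power_sum_def by simp
qed

section \<open>Primes congruent to 1 modulo a prime power\<close>

text \<open>A cyclotomic argument: let \<open>p\<close> divide
  \<open>1 + y + ... + y ^ (q - 1)\<close> where \<open>y = x ^ (q ^ (N - 1))\<close>. Then
  \<open>x\<close> has order exactly \<open>q ^ N\<close> modulo \<open>p\<close>, so
  \<open>q ^ N\<close> divides \<open>p - 1\<close>. Taking \<open>x = q * fact b\<close> forces
  \<open>p > b\<close> and \<open>p \<noteq> q\<close>.\<close>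

lemma infinite_primes_1_mod_prime_power:
  fixes q N :: nat
  assumes q: "prime q"
  shows "infinite {p. prime p \<and> [p = 1] (mod q ^ N)}"
proof (cases N)
  case 0
  then show ?thesis using primes_infinite by simp
next
  case (Suc M)
  have "\<exists>p>b. prime p \<and> [p = 1] (mod q ^ N)" for b :: nat
  proof -
    define x where "x = q * fact b"
    define y where "y = x ^ (q ^ M)"
    have q2: "q \<ge> 2" using q by (rule prime_ge_2_nat)
    have x: "x \<ge> 2" unfolding x_def using mult_le_mono[OF q2 fact_ge_1[of b]] by simp
    have "x ^ 1 \<le> y" unfolding y_def using x q2 by (intro power_increasing) (auto simp: Suc_le_eq)
    then have y1: "y \<ge> 2" using x by simp
    define c where "c = (\<Sum>i<q. y ^ i)"
    have c_eq: "c = 1 + y * (\<Sum>i<q - 1. y ^ i)"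
    proof -
      have "c = (\<Sum>i<Suc (q - 1). y ^ i)" unfolding c_def using q2 by simp
      then show ?thesis unfolding sum.lessThan_Suc_shift by (simp add: sum_distrib_left)
    qed
    have "(\<Sum>i<q - 1. y ^ i) \<noteq> 0" using q2 y1 by (auto simp: lessThan_empty_iff intro!: exI[of _ 0])
    then have "c \<noteq> 1" using c_eq y1 by simp
    then obtain p where p: "prime p" "p dvd c" using prime_factor_nat by blast
    have pnx: "\<not> p dvd x"
    proof
      assume "p dvd x"
      then have "p dvd y" unfolding y_def using q2 by (simp add: dvd_trans[OF _ dvd_power])
      then have "p dvd 1" using p(2) c_eq by (metis dvd_add_left_iff dvd_mult2)
      then show False using p(1) by simp
    qed
    have "p > b"
    proof (rule ccontr)
      assume "\<not> p > b"
      then have "p dvd fact b" using p(1) by (simp add: prime_dvd_fact_iff)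
      then show False using pnx unfolding x_def by simp
    qed
    moreover have "[p = 1] (mod q ^ N)"
    proof -
      have cop: "coprime p x" using p(1) pnx by (rule prime_imp_coprime_nat)
      have "[y ^ q = 1] (mod p)"
      proof -
        \<comment> \<open>The identity \<open>(y - 1) * c = y ^ q - 1\<close>, rearranged to avoid
          subtraction of naturals.\<close>
        have "c + y ^ q = (\<Sum>i<Suc q. y ^ i)" unfolding c_def by simp
        also have "\<dots> = 1 + y * c"
          unfolding sum.lessThan_Suc_shift c_def by (simp add: sum_distrib_left)
        finally have "[c + y ^ q = 1 + y * c] (mod p)" by simp
        moreover have c0: "[c = 0] (mod p)" using p(2) by (simp add: cong_0_iff)
        have "[c + y ^ q = 0 + y ^ q] (mod p)" "[1 + y * c = 1 + y * 0] (mod p)"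
          by (intro cong_add cong_mult cong_refl c0)+
        ultimately show ?thesis unfolding cong_def by simp
      qed
      then have "ord p x dvd q ^ N" unfolding y_def Suc ord_divides[symmetric]
        by (simp add: power_mult[symmetric] mult.commute)
      \<comment> \<open>Otherwise \<open>y\<close> is 1 modulo \<open>p\<close>, all
        \<open>q\<close> summands of \<open>c\<close> are 1, and \<open>p\<close> divides
        \<open>q\<close> and hence \<open>x\<close>.\<close>
      moreover have "\<not> ord p x dvd q ^ M"
      proof
        assume "ord p x dvd q ^ M"
        then have "[y = 1] (mod p)" unfolding y_def ord_divides[symmetric] .
        then have "[c = (\<Sum>i<q. 1 ^ i)] (mod p)" unfolding c_def by (intro cong_sum cong_pow)
        then have "[c = q] (mod p)" by simp
        then have "p dvd q" using p(2) cong_dvd_iff by blast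
        then show False using pnx unfolding x_def by simp
      qed
      moreover obtain i where i: "i \<le> N" "ord p x = q ^ i"
        using \<open>ord p x dvd q ^ N\<close> divides_primepow_nat[OF q] by blast
      ultimately have "\<not> i \<le> M" using le_imp_power_dvd[of i M q] by auto
      with i have "ord p x = q ^ N" unfolding Suc by (simp add: le_Suc_eq)
      moreover have "ord p x dvd p - 1" using cop p(1) order_divides_totient[of p x]
        by (simp add: totient_prime coprime_commute)
      ultimately show ?thesis using p(1) prime_ge_1_nat[of p]
        by (simp add: cong_altdef_nat)
    qed
    ultimately show ?thesis using p(1) by (intro exI[of _ p]) simp
  qed
  then show ?thesis by (simp add: infinite_nat_iff_unbounded)
qed

section \<open>Consequences of membership in \<open>D1\<close>\<close>

text \<open>Divide \<open>phi k n\<close> and \<open>phi 1 n\<close> by their common factor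
  \<open>w\<close>. The latter becomes \<open>n ^ 2 / 2\<close>, so twice the sum left from the
  former is an integer, and 2 is a unit at the odd prime \<open>q\<close>. Modulo
  \<open>q ^ N\<close> one may then put 1 for \<open>n\<close> and \<open>1 - j\<close> for each
  factor; as \<open>q ^ N\<close> clears the denominators of the coefficients, this changes the sum
  by a \<open>q\<close>-integral amount.\<close>

lemma D1_psum_coeff_loc:
  assumes k: "k \<in> D1" and q: "prime q" "odd q" and r: "r \<ge> 1"
  shows "(\<Sum>j\<le>k. psum_coeff k j * (1 - of_nat j) ^ r) \<in> loc q"
proof -
  obtain N where N: "\<And>j. j < Suc k \<Longrightarrow> of_nat q ^ N * psum_coeff k j \<in> loc q"
    using loc_denom_uniform[OF q(1)] by metis
  obtain A where A: "finite A" "card A = r" "A \<subseteq> {p. prime p \<and> [p = 1] (mod q ^ N)}"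
    using infinite_arbitrarily_large[OF infinite_primes_1_mod_prime_power[OF q(1)]] by metis
  then have pr: "\<And>p. p \<in> A \<Longrightarrow> prime p" and c1: "\<And>p. p \<in> A \<Longrightarrow> [p = 1] (mod q ^ N)" by auto
  have "A \<noteq> {}" using A r by auto
  define n where "n = \<Prod>A"
  \<comment> \<open>This is \<open>(1 - p ^ (j - 1)) / (1 - 1 / p)\<close> as a geometric sum, which
    shows that it is an integer and is \<open>1 - j\<close> modulo \<open>q ^ N\<close>.\<close>
  define e where "e p j = 1 - (\<Sum>i<j. int p ^ i)" for p j :: nat
  define w where "w = (\<Prod>p\<in>A. 1 - 1 / of_nat p :: rat)"
  have w0: "w \<noteq> 0" unfolding w_def using A(1) pr prime_gt_1_nat by fastforce
  have n0: "n > 0" unfolding n_def using A(1) pr prime_gt_0_nat by (simp add: prod_pos)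
  have factor: "1 - of_nat p ^ j / of_nat p = (1 - 1 / of_nat p) * (of_int (e p j) :: rat)" if "p \<in> A" for p j
  proof -
    have p: "p > 0" using pr[OF that] by (simp add: prime_gt_0_nat)
    have "of_nat p ^ j - 1 = (of_nat p - 1) * (\<Sum>i<j. of_nat p ^ i :: rat)"
      by (rule power_diff_1_eq)
    then have "of_nat p - of_nat p ^ j = (of_nat p - 1) * (of_int (e p j) :: rat)"
      unfolding e_def by (simp add: algebra_simps)
    then show ?thesis using p by (simp add: field_simps)
  qed
  have phi: "of_nat (phi m n) = w * (\<Sum>j\<le>m. psum_coeff m j * of_nat n ^ (Suc m - j) * of_int (\<Prod>p\<in>A. e p j))" for m
  proof -
    have "of_nat (phi m n) =
        (\<Sum>j\<le>m. psum_coeff m j * of_nat n ^ (Suc m - j) * (\<Prod>p\<in>A. 1 - of_nat p ^ j / of_nat p))"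
      using coprime_power_sum_formula[OF A(1) pr dvd_refl] phi_prod_primes[OF A(1) \<open>A \<noteq> {}\<close> pr]
      unfolding n_def by simp
    also have "\<dots> = w * (\<Sum>j\<le>m. psum_coeff m j * of_nat n ^ (Suc m - j) * of_int (\<Prod>p\<in>A. e p j))"
      unfolding sum_distrib_left w_def
      by (intro sum.cong) (simp_all add: factor prod.distrib mult_ac)
    finally show ?thesis .
  qed
  have "phi 1 n dvd phi k n" using k n0 unfolding D1_def by simp
  then obtain z where z: "phi k n = phi 1 n * z" by (elim dvdE)
  \<comment> \<open>As \<open>A\<close> is nonempty, the term \<open>j = 1\<close> of
    \<open>phi 1 n\<close> vanishes and only \<open>j = 0\<close>, with coefficient 1/2,
    remains.\<close>
  have "e p 1 = 0" "e p 0 = 1" for p unfolding e_def by simp_all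
  then have "of_nat (phi 1 n) = w * of_nat n ^ 2 / (2 :: rat)"
    unfolding phi using A(1) \<open>A \<noteq> {}\<close> by (simp add: psum_coeff_def power2_eq_square card_gt_0_iff)
  then have "of_int 2 * (\<Sum>j\<le>k. psum_coeff k j * of_nat n ^ (Suc k - j) * of_int (\<Prod>p\<in>A. e p j)) = (of_nat (n ^ 2 * z) :: rat)"
    (is "of_int 2 * ?S = _")
  proof -
    assume "of_nat (phi 1 n) = w * of_nat n ^ 2 / (2 :: rat)"
    then have "w * ?S = w * of_nat n ^ 2 / 2 * of_nat z"
      unfolding phi[of k, symmetric] unfolding z by simp
    then have "w * (2 * ?S) = w * of_nat (n ^ 2 * z)" by (simp add: mult_ac)
    then show ?thesis using w0 by simp
  qed
  moreover have "\<not> int q dvd 2"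
    using q prime_ge_2_nat[of q] by (cases "q = 2") (auto dest: zdvd_imp_le)
  ultimately have 1: "(\<Sum>j\<le>k. psum_coeff k j * of_nat n ^ (Suc k - j) * of_int (\<Prod>p\<in>A. e p j)) \<in> loc q"
    using loc_cancel[OF q(1)] loc_of_nat[OF q(1)] by metis
  have "psum_coeff k j * of_nat n ^ (Suc k - j) * of_int (\<Prod>p\<in>A. e p j) - psum_coeff k j * (1 - of_nat j) ^ r \<in> loc q"
    if "j \<le> k" for j
  proof -
    have "[int p = 1] (mod int q ^ N)" if "p \<in> A" for p
      using c1[OF that] by (metis cong_int_iff of_nat_1 of_nat_power)
    then have "[int n ^ (Suc k - j) * (\<Prod>p\<in>A. e p j) = (\<Prod>p\<in>A. 1) ^ (Suc k - j) * (\<Prod>p\<in>A. 1 - (\<Sum>i<j. 1 ^ i))] (mod int q ^ N)"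
      unfolding n_def e_def of_nat_prod
      by (intro cong_mult cong_pow cong_prod cong_diff cong_sum cong_refl) auto
    then have "[int n ^ (Suc k - j) * (\<Prod>p\<in>A. e p j) = (1 - int j) ^ r] (mod int q ^ N)"
      using A(2) by simp
    then obtain t where t: "int n ^ (Suc k - j) * (\<Prod>p\<in>A. e p j) - (1 - int j) ^ r = int q ^ N * t"
      unfolding cong_iff_dvd_diff by (elim dvdE)
    have "of_nat n ^ (Suc k - j) * of_int (\<Prod>p\<in>A. e p j) - (1 - of_nat j) ^ r = (of_nat q ^ N * of_int t :: rat)"
      using arg_cong[OF t, of "of_int :: int \<Rightarrow> rat"] by simp
    then have "psum_coeff k j * of_nat n ^ (Suc k - j) * of_int (\<Prod>p\<in>A. e p j) - psum_coeff k j * (1 - of_nat j) ^ r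
       = (of_nat q ^ N * psum_coeff k j) * of_int t"
      by (simp add: algebra_simps flip: right_diff_distrib)
    then show ?thesis using N[of j] that loc_mult[OF q(1) _ loc_of_int[OF q(1)]] by simp
  qed
  then have "(\<Sum>j\<le>k. psum_coeff k j * of_nat n ^ (Suc k - j) * of_int (\<Prod>p\<in>A. e p j) - psum_coeff k j * (1 - of_nat j) ^ r) \<in> loc q"
    by (intro loc_sum q) simp
  from loc_diff[OF q(1) 1 this] show ?thesis by (simp add: sum_subtractf)
qed

text \<open>Linear factors are adjoined one at a time through
  \<open>j - t = (1 - t) - (1 - j)\<close>, at the price of raising \<open>r\<close> in one of the
  two terms.\<close>

lemma D1_psum_coeff_prod_loc:
  fixes T :: "nat set"
  assumes k: "k \<in> D1" and q: "prime q" "odd q" and "finite T" and "r \<ge> 1"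
  shows "(\<Sum>j\<le>k. psum_coeff k j * ((1 - of_nat j) ^ r * (\<Prod>t\<in>T. of_nat j - of_nat t))) \<in> loc q"
  using assms(4,5)
proof (induction T arbitrary: r rule: finite_induct)
  case empty
  then show ?case using D1_psum_coeff_loc[OF k q] by simp
next
  case (insert t T)
  have "of_int (1 - int t) * (\<Sum>j\<le>k. psum_coeff k j * ((1 - of_nat j) ^ r * (\<Prod>t\<in>T. of_nat j - of_nat t)))
      - (\<Sum>j\<le>k. psum_coeff k j * ((1 - of_nat j) ^ Suc r * (\<Prod>t\<in>T. of_nat j - of_nat t))) \<in> loc q"
    using insert by (intro loc_diff loc_mult loc_of_int q insert.IH) auto
  also have "of_int (1 - int t) * (\<Sum>j\<le>k. psum_coeff k j * ((1 - of_nat j) ^ r * (\<Prod>t\<in>T. of_nat j - of_nat t)))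
      - (\<Sum>j\<le>k. psum_coeff k j * ((1 - of_nat j) ^ Suc r * (\<Prod>t\<in>T. of_nat j - of_nat t)))
      = (\<Sum>j\<le>k. psum_coeff k j * ((1 - of_nat j) ^ r * (\<Prod>t\<in>insert t T. of_nat j - of_nat t)))"
    unfolding sum_distrib_left sum_subtractf[symmetric] using insert.hyps
    by (intro sum.cong) (auto simp: algebra_simps)
  finally show ?case .
qed

section \<open>From integrality of Bernoulli sums to an inequality between residues of
  \<open>k\<close>\<close>

lemma prod_diff_fact:
  assumes "c \<le> j"
  shows "(\<Prod>t<c. of_nat j - of_nat t) * fact (j - c) = (fact j :: 'a :: {comm_ring_1,semiring_char_0})"
  using assms
proof (induction c)
  case (Suc c)
  then have "j - c = Suc (j - Suc c)" by simp
  then have "fact (j - c) = (of_nat (j - c) * fact (j - Suc c) :: 'a)" by (metis fact_Suc)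
  then show ?case using Suc by (simp add: of_nat_diff mult.assoc)
qed simp

text \<open>Multiplying by the falling factorial \<open>j * (j - 1) * ... * (j - c)\<close> removes
  the denominator \<open>k + 1\<close>; both sides are the same quotient of factorials times
  \<open>bernoulli j\<close>.\<close>

lemma psum_coeff_mult_prod:
  assumes "c < j" "j \<le> k"
  shows "psum_coeff k j * (\<Prod>t<Suc c. of_nat j - of_nat t) =
    (\<Prod>t<c. of_nat k - of_nat t) * (of_nat ((k - c) choose (j - Suc c)) * bernoulli j)"
proof -
  have 1: "(\<Prod>t<Suc c. of_nat j - of_nat t) = (fact j / fact (j - Suc c) :: rat)"
    using prod_diff_fact[of "Suc c" j, where 'a = rat] assms by (simp add: field_simps del: prod.lessThan_Suc)
  have 2: "(\<Prod>t<c. of_nat k - of_nat t) = (fact k / fact (k - c) :: rat)"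
    using prod_diff_fact[of c k, where 'a = rat] assms by (simp add: field_simps)
  have 3: "of_nat (Suc k choose j) = (of_nat (Suc k) * fact k / (fact j * fact (Suc k - j)) :: rat)"
    using assms binomial_fact[of j "Suc k", where 'a = rat] by (simp add: fact_Suc del: binomial_Suc_Suc)
  have "k - c - (j - Suc c) = Suc k - j" using assms by simp
  then have 4: "of_nat ((k - c) choose (j - Suc c)) = (fact (k - c) / (fact (j - Suc c) * fact (Suc k - j)) :: rat)"
    using assms binomial_fact[of "j - Suc c" "k - c", where 'a = rat] by simp
  show ?thesis unfolding psum_coeff_def 1 2 3 4 by (simp del: of_nat_Suc)
qed

text \<open>The polynomial \<open>j * (j - 1) * ... * (j - c)\<close> vanishes at 1 since
  \<open>c \<ge> 1\<close>. It brings out the factor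
  \<open>K = k * (k - 1) * ... * (k - c + 1)\<close>, which can be cancelled because
  \<open>c \<le> k mod q\<close> keeps multiples of \<open>q\<close> out of it.\<close>

lemma D1_bernoulli_sum_loc:
  assumes k: "k \<in> D1" and q: "prime q" "odd q" and c: "1 \<le> c" "c \<le> k mod q"
  shows "(\<Sum>b<k-c. of_nat ((k - c) choose b) * bernoulli (b + Suc c)) \<in> loc q"
proof -
  have ck: "c \<le> k" using c mod_less_eq_dividend le_trans by blast
  define K where "K = (\<Prod>t<c. int k - int t)"
  have lessThan: "{..<Suc c} = insert 1 (insert 0 {2..c})" using c(1) by auto
  \<comment> \<open>The factor at \<open>t = 1\<close> is written as \<open>-(1 - j)\<close>, which
    supplies the required power with \<open>r = 1\<close>.\<close>
  have P: "(1 - of_nat j) ^ 1 * (\<Prod>t\<in>insert 0 {2..c}. of_nat j - of_nat t) = - (\<Prod>t<Suc c. of_nat j - of_nat t :: rat)" for j :: nat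
    unfolding lessThan by (simp add: algebra_simps)
  have "(\<Sum>j\<le>k. psum_coeff k j * ((1 - of_nat j) ^ 1 * (\<Prod>t\<in>insert 0 {2..c}. of_nat j - of_nat t))) \<in> loc q"
    by (rule D1_psum_coeff_prod_loc[OF k q]) auto
  then have "0 - (\<Sum>j\<le>k. psum_coeff k j * (\<Prod>t<Suc c. of_nat j - of_nat t)) \<in> loc q"
    unfolding P by (simp add: sum_negf del: prod.lessThan_Suc)
  from loc_diff[OF q(1) _ this, of 0]
  have "(\<Sum>j\<le>k. psum_coeff k j * (\<Prod>t<Suc c. of_nat j - of_nat t)) \<in> loc q"
    using loc_of_int[OF q(1), of 0] by (simp del: prod.lessThan_Suc)
  also have "(\<Sum>j\<le>k. psum_coeff k j * (\<Prod>t<Suc c. of_nat j - of_nat t)) =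
      (\<Sum>j\<in>{Suc c..k}. psum_coeff k j * (\<Prod>t<Suc c. of_nat j - of_nat t))"
    by (rule sum.mono_neutral_right) (auto simp: prod_zero_iff simp del: prod.lessThan_Suc)
  also have "\<dots> = (\<Sum>j\<in>{Suc c..k}. of_int K * (of_nat ((k - c) choose (j - Suc c)) * bernoulli j))"
    by (rule sum.cong) (auto simp: psum_coeff_mult_prod K_def simp del: prod.lessThan_Suc)
  also have "\<dots> = of_int K * (\<Sum>b<k-c. of_nat ((k - c) choose b) * bernoulli (b + Suc c))"
    unfolding sum_distrib_left
    by (rule sum.reindex_bij_witness[of _ "\<lambda>b. b + Suc c" "\<lambda>j. j - Suc c"]) auto
  finally have *: "of_int K * (\<Sum>b<k-c. of_nat ((k - c) choose b) * bernoulli (b + Suc c)) \<in> loc q" .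
  have "\<not> int q dvd K"
  proof
    assume "int q dvd K"
    then obtain t where t: "t < c" "int q dvd int k - int t"
      unfolding K_def using q(1) by (auto simp: prime_dvd_prod_iff)
    then have "q dvd k - t" using ck by (metis int_dvd_int_iff of_nat_diff less_imp_le le_trans)
    then have "k mod q = t mod q" using t(1) ck by (simp add: mod_eq_dvd_iff_nat)
    moreover have "t mod q \<le> t" by simp
    ultimately show False using t c by linarith
  qed
  with * show ?thesis using loc_cancel q(1) by blast
qed

text \<open>Replace each Bernoulli number by its power sum over \<open>q\<close> and sum over
  \<open>b\<close> first. The binomial expansion lacks its top term \<open>b = k - c\<close>, whence
  the subtracted power.\<close>

lemma D1_power_sum_dvd:
  assumes k: "k \<in> D1" and q: "prime q" "odd q" and c: "1 \<le> c" "c \<le> k mod q"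
  shows "int q dvd (\<Sum>g<q. int g ^ Suc c * ((int g + 1) ^ (k - c) - int g ^ (k - c)))"
proof -
  define m where "m = k - c"
  define Z where "Z = (\<Sum>b<m. of_nat (m choose b) * (\<Sum>g<q. int g ^ (b + Suc c)))"
  have "(\<Sum>b<m. of_nat (m choose b) * bernoulli (b + Suc c)) -
      (\<Sum>b<m. of_nat (m choose b) * (bernoulli (b + Suc c) - (\<Sum>g<q. of_nat g ^ (b + Suc c)) / of_nat q)) \<in> loc q"
    using D1_bernoulli_sum_loc[OF k q c] unfolding m_def
    by (rule loc_diff[OF q(1)])
      (intro loc_sum[OF q(1)] loc_mult[OF q(1) loc_of_nat[OF q(1)]] bernoulli_cong_power_sum[OF q])
  also have "(\<Sum>b<m. of_nat (m choose b) * bernoulli (b + Suc c)) -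
      (\<Sum>b<m. of_nat (m choose b) * (bernoulli (b + Suc c) - (\<Sum>g<q. of_nat g ^ (b + Suc c)) / of_nat q))
      = of_int Z / of_nat q"
    unfolding Z_def sum_subtractf[symmetric]
    by (simp add: sum_divide_distrib[symmetric] right_diff_distrib)
  finally have "int q dvd Z" using loc_div_dvd q(1) by blast
  also have "Z = (\<Sum>g<q. int g ^ Suc c * (\<Sum>b<m. of_nat (m choose b) * int g ^ b))"
    unfolding Z_def sum_distrib_left by (subst sum.swap) (simp add: power_add mult_ac)
  also have "(\<lambda>g. \<Sum>b<m. of_nat (m choose b) * int g ^ b) = (\<lambda>g. (int g + 1) ^ m - int g ^ m)"
    unfolding binomial_ring by (simp flip: lessThan_Suc_atMost)
  finally show ?thesis unfolding m_def .
qed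

text \<open>Otherwise \<open>c = k mod (q - 1)\<close> is admissible in
  \<open>D1_power_sum_dvd\<close>. As \<open>q - 1\<close> divides \<open>k - c > 0\<close>, Fermat
  makes both powers 1 unless \<open>g\<close> is \<open>0\<close> or \<open>q - 1\<close>. The
  former contributes 0 and the latter -1, so \<open>q\<close> would divide -1.\<close>

lemma D1_mod_less:
  assumes k: "k \<in> D1" "odd k" and q: "prime q" "odd q" "q - 1 \<le> k"
  shows "k mod q < k mod (q - 1)"
proof (rule ccontr)
  define c where "c = k mod (q - 1)"
  assume "\<not> k mod q < k mod (q - 1)"
  then have cq: "c \<le> k mod q" unfolding c_def by simp
  have q2: "q > 2" using q prime_ge_2_nat[of q] by (cases "q = 2") auto
  \<comment> \<open>Parity survives reduction modulo the even number \<open>q - 1\<close>; it gives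
    \<open>c \<ge> 1\<close> here and the sign of the term \<open>g = q - 1\<close> below.\<close>
  have "odd c" unfolding c_def using k(2) q(2) by (simp add: dvd_mod_iff)
  then have c1: "1 \<le> c" by (cases c) auto
  have "c < q - 1" unfolding c_def using q2 by simp
  define d where "d = k div (q - 1)"
  have kc: "k - c = (q - 1) * d" "k = c + (q - 1) * d" unfolding c_def d_def by (simp_all add: minus_mod_eq_mult_div)
  have "d > 0" unfolding d_def using q(3) q2 by (simp add: div_greater_zero_iff)
  have fermat: "[int g ^ ((q - 1) * d) = 1] (mod int q)" if "\<not> q dvd g" for g
  proof -
    have "[g ^ (q - 1) = 1] (mod q)" using fermat_theorem q(1) that by blast
    then have "[(g ^ (q - 1)) ^ d = 1 ^ d] (mod q)" by (rule cong_pow)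
    then show ?thesis by (simp add: power_mult flip: cong_int_iff)
  qed
  have "[int g ^ Suc c * ((int g + 1) ^ (k - c) - int g ^ (k - c)) = (if g = q - 1 then - 1 else 0)] (mod int q)"
    if "g < q" for g
  proof -
    consider "g = 0" | "g = q - 1" | "g > 0" "g < q - 1" using \<open>g < q\<close> by linarith
    then show ?thesis
    proof cases
      case 1
      then show ?thesis using q2 by simp
    next
      case 2
      have "int g = int q - 1" using 2 q2 by simp
      then have "[int g = - 1] (mod int q)" by (simp add: cong_iff_dvd_diff)
      then have "[int g ^ Suc c * ((int g + 1) ^ (k - c) - int g ^ (k - c)) =
          (- 1) ^ Suc c * ((- 1 + 1) ^ (k - c) - (- 1) ^ (k - c))] (mod int q)"
        by (intro cong_mult cong_diff cong_pow cong_add cong_refl)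
      moreover have "even (Suc c)" "even (k - c)" using \<open>odd c\<close> k(2) q(2) unfolding kc(1) by auto
      moreover have "k - c > 0" using kc \<open>d > 0\<close> q2 by simp
      ultimately have "[int g ^ Suc c * ((int g + 1) ^ (k - c) - int g ^ (k - c)) = - 1] (mod int q)"
        by (simp add: power_0_left)
      then show ?thesis using 2 by simp
    next
      case 3
      have "\<not> q dvd g" "\<not> q dvd (g + 1)" using 3 by (auto dest: dvd_imp_le)
      then have "[(int g + 1) ^ (k - c) - int g ^ (k - c) = 1 - 1] (mod int q)"
        using fermat[of g] fermat[of "g + 1"] unfolding kc(1) by (intro cong_diff) (auto simp: add.commute)
      then have "[int g ^ Suc c * ((int g + 1) ^ (k - c) - int g ^ (k - c)) = int g ^ Suc c * (1 - 1)] (mod int q)"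
        by (intro cong_mult cong_refl)
      then show ?thesis using 3 by simp
    qed
  qed
  then have "[(\<Sum>g<q. int g ^ Suc c * ((int g + 1) ^ (k - c) - int g ^ (k - c))) = (\<Sum>g<q. if g = q - 1 then - 1 else 0)] (mod int q)"
    by (intro cong_sum) simp
  also have "(\<Sum>g<q. if g = q - 1 then - 1 else 0) = (- 1 :: int)"
    using q2 by (simp add: sum.delta)
  finally have cong: "[(\<Sum>g<q. int g ^ Suc c * ((int g + 1) ^ (k - c) - int g ^ (k - c))) = - 1] (mod int q)" .
  have "int q dvd - 1"
    using D1_power_sum_dvd[OF k(1) q(1,2) c1 cq] unfolding cong_dvd_iff[OF cong] .
  then show False using q2 by simp
qed

section \<open>The exponents in \<open>D1\<close>\<close>

text \<open>Test \<open>n = 3\<close>: \<open>phi 1 3 = 3\<close>, while \<open>1 + 2 ^ k\<close> is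
  2 modulo 3 for even \<open>k\<close>.\<close>

lemma D1_odd:
  assumes "k \<in> D1"
  shows "odd k"
proof -
  have "gcd 3 3 = (3 :: nat)" "gcd 1 3 = (1 :: nat)" "gcd 2 3 = (1 :: nat)" by (simp_all add: gcd_non_0_nat)
  then have "{a. 1 \<le> a \<and> a \<le> 3 \<and> gcd a 3 = 1} = {1, 2 :: nat}"
    by (auto simp: le_Suc_eq numeral_3_eq_3)
  then have "phi m 3 = 1 + 2 ^ m" for m unfolding phi_def by simp
  moreover have "phi 1 3 dvd phi k 3" using assms unfolding D1_def by simp
  ultimately have "3 dvd 1 + (2 :: nat) ^ k" by simp
  moreover have "\<not> 3 dvd 1 + (2 :: nat) ^ (2 * m)" for m
  proof -
    have "[1 + (2 ^ 2) ^ m = 1 + 1 ^ m] (mod (3 :: nat))"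
      by (intro cong_add cong_pow cong_refl) (simp add: cong_def)
    then have "3 dvd 1 + (2 ^ 2 :: nat) ^ m \<longleftrightarrow> 3 dvd 1 + (1 :: nat) ^ m" by (rule cong_dvd_iff)
    moreover have "\<not> 3 dvd 1 + (1 :: nat) ^ m" by (auto dest: dvd_imp_le)
    ultimately show ?thesis unfolding power_mult by blast
  qed
  ultimately show ?thesis by (metis evenE)
qed

text \<open>Here \<open>k mod q\<close> would be \<open>q - 1\<close>, above every residue modulo
  \<open>q - 1\<close>.\<close>

lemma D1_odd_prime_not_dvd_add1:
  assumes "k \<in> D1" "prime q" "odd q"
  shows "\<not> q dvd k + 1"
proof
  assume "q dvd k + 1"
  moreover have q: "q > 2" using assms prime_ge_2_nat[of q] by (cases "q = 2") auto
  ultimately have "k mod q = q - 1" "q - 1 \<le> k"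
    using dvd_imp_le[of q "k + 1"] by (auto simp: mod_Suc dvd_eq_mod_eq_0 split: if_splits)
  with D1_mod_less[OF assms(1) D1_odd[OF assms(1)] assms(2,3)] have "q - 1 < k mod (q - 1)" by simp
  then show False using mod_less_divisor[of "q - 1" k] q by linarith
qed

text \<open>Here \<open>k mod q = q - 2\<close> is already the largest residue modulo
  \<open>q - 1\<close>. Only \<open>k = q - 2\<close> escapes, being too small for
  \<open>D1_mod_less\<close>.\<close>

lemma D1_odd_prime_dvd_add2:
  assumes "k \<in> D1" "prime q" "odd q" "q dvd k + 2"
  shows "q = k + 2"
proof (rule ccontr)
  assume "q \<noteq> k + 2"
  have q: "q > 2" using assms prime_ge_2_nat[of q] by (cases "q = 2") auto
  obtain m where m: "k + 2 = q * m" using assms(4) by (elim dvdE)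
  with \<open>q \<noteq> k + 2\<close> have "m \<ge> 2" by (cases m; cases "m - 1") auto
  then obtain m' where m': "m = Suc (Suc m')" by (metis add_2_eq_Suc le_Suc_ex)
  have "k = (q - 2) + q * Suc m'" using m q unfolding m' by (simp add: algebra_simps)
  moreover from this have "k mod q = (q - 2) mod q" by (metis mod_mult_self2)
  ultimately have "k mod q = q - 2" "q - 1 \<le> k" using q by auto
  with D1_mod_less[OF assms(1) D1_odd[OF assms(1)] assms(2,3)] have "q - 2 < k mod (q - 1)" by simp
  then show False using mod_less_divisor[of "q - 1" k] q by linarith
qed

lemma pow2_mult_odd:
  fixes n :: nat
  assumes "n > 0"
  obtains v u where "n = 2 ^ v * u" "odd u"
proof -
  have "\<not> is_unit (2 :: nat)" by simp
  then obtain u where "n = 2 ^ multiplicity 2 n * u" "odd u"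
    using assms multiplicity_decompose'[of n 2] by blast
  then show thesis by (rule that)
qed

text \<open>Without odd prime factors, \<open>k + 1\<close> is \<open>2 ^ v\<close>. If
  \<open>v\<close> had an odd factor \<open>w > 1\<close>, then \<open>k + 2 = x ^ w + 1\<close>
  would have the proper divisor \<open>x + 1\<close>, and with it an odd prime factor below
  \<open>k + 2\<close>.\<close>

lemma D1_add1_eq_fermat:
  assumes k: "k \<in> D1"
  obtains i where "k + 1 = 2 ^ 2 ^ i"
proof -
  have k1: "k \<ge> 1" using k unfolding D1_def by simp
  obtain v u where u: "k + 1 = 2 ^ v * u" "odd u" by (rule pow2_mult_odd[of "k + 1"]) auto
  have "u = 1"
  proof (rule ccontr)
    assume "u \<noteq> 1"
    then obtain q where q: "prime q" "q dvd u" using prime_factor_nat by blast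
    then have "odd q" using u(2) dvd_trans by blast
    then show False using D1_odd_prime_not_dvd_add1[OF k q(1)] u(1) q(2) by simp
  qed
  with u have v: "k + 1 = 2 ^ v" by simp
  with k1 have "v > 0" by (cases v) auto
  then obtain i w where w: "v = 2 ^ i * w" "odd w" by (rule pow2_mult_odd)
  define x :: nat where "x = 2 ^ 2 ^ i"
  have x: "even x" "x \<ge> 2" unfolding x_def using self_le_power[of "2 :: nat" "2 ^ i"] by auto
  have kx: "k + 1 = x ^ w" unfolding v w x_def by (simp add: power_mult)
  have "w = 1"
  proof (rule ccontr)
    assume "w \<noteq> 1"
    then have "w > 1" using w(2) by (cases w) auto
    have "[int x = - 1] (mod int x + 1)" by (simp add: cong_iff_dvd_diff)
    then have "[int x ^ w = (- 1) ^ w] (mod int x + 1)" by (rule cong_pow)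
    then have "int x + 1 dvd int x ^ w + 1" using w(2) by (simp add: cong_iff_dvd_diff)
    moreover have "int (k + 2) = int x ^ w + 1" using arg_cong[OF kx, of int] by simp
    ultimately have "int (x + 1) dvd int (k + 2)" by (simp add: add.commute)
    then have d: "x + 1 dvd k + 2" by (simp only: int_dvd_int_iff)
    obtain q where q: "prime q" "q dvd x + 1" using prime_factor_nat[of "x + 1"] x by auto
    then have "odd q" using x(1) by (metis dvd_add_right_iff dvd_trans odd_one)
    then have "q = k + 2" using D1_odd_prime_dvd_add2[OF k q(1)] d q(2) dvd_trans by blast
    moreover have "x ^ 1 < x ^ w" using x \<open>w > 1\<close> by (intro power_strict_increasing) auto
    moreover have "q \<le> x + 1" using q(2) by (intro dvd_imp_le) auto
    ultimately show False using kx by simp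
  qed
  then show ?thesis using that v w by simp
qed

section \<open>Residues of \<open>2 ^ 2 ^ i\<close> modulo 13, 12, 241 and 240\<close>

lemma power_cong_periodic:
  fixes a :: "'a :: unique_euclidean_semiring"
  assumes "[a ^ (s + d) = a ^ s] (mod m)"
  shows "[a ^ (s + d * u) = a ^ s] (mod m)"
proof (induction u)
  case (Suc u)
  have "[a ^ (s + d * u) * a ^ d = a ^ s * a ^ d] (mod m)" using Suc by (intro cong_mult cong_refl)
  then have "[a ^ (s + d * Suc u) = a ^ (s + d)] (mod m)" by (simp add: power_add mult_ac)
  then show ?case using assms cong_trans by blast
qed simp

text \<open>The inner power has period \<open>d\<close> modulo \<open>b\<close>, and
  \<open>b\<close> is a period of the outer one. The offset \<open>s\<close> allows bases not
  coprime to the modulus, such as 2 modulo 12 or 240.\<close>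

lemma power_power_cong_periodic:
  fixes a b c m :: nat
  assumes "[a ^ (s + d) = a ^ s] (mod b)" "[c ^ (a ^ s + b) = c ^ (a ^ s)] (mod m)"
    and "a > 0"
  shows "[c ^ a ^ (s + d * u) = c ^ a ^ s] (mod m)"
proof -
  have le: "a ^ s \<le> a ^ (s + d * u)" using assms(3) by (intro power_increasing) auto
  then have "b dvd a ^ (s + d * u) - a ^ s"
    using power_cong_periodic[OF assms(1), of u] by (simp only: cong_altdef_nat)
  then obtain v where "a ^ (s + d * u) - a ^ s = b * v" by (elim dvdE)
  with le have "a ^ (s + d * u) = a ^ s + b * v" by linarith
  then show ?thesis using power_cong_periodic[OF assms(2)] by simp
qed

text \<open>All residues are those at \<open>t = 0\<close>, of \<open>2 ^ 8\<close> and
  \<open>2 ^ 16\<close>. The inner moduli 12 and 24 are the orders of 2 modulo 13 and 241.\<close>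

lemma power_power_2_mod:
  "(2 :: nat) ^ 2 ^ (3 + 2 * t) mod 13 = 9" "(2 :: nat) ^ 2 ^ (3 + 2 * t) mod 12 = 4"
  "(2 :: nat) ^ 2 ^ (4 + 2 * t) mod 241 = 225" "(2 :: nat) ^ 2 ^ (4 + 2 * t) mod 240 = 16"
  using power_power_cong_periodic[of 2 3 2 12 2 13 t] power_power_cong_periodic[of 2 3 2 12 2 12 t]
    power_power_cong_periodic[of 2 4 2 24 2 241 t] power_power_cong_periodic[of 2 4 2 24 2 240 t]
  by (simp_all add: cong_def)

theorem theorem1:
  shows "D1 \<subseteq> {1, 3, 15}"
proof
  fix k assume k: "k \<in> D1"
  obtain i where i: "k + 1 = 2 ^ 2 ^ i" using D1_add1_eq_fermat[OF k] .
  \<comment> \<open>Unequal residues already imply \<open>q - 1 \<le> k\<close>, since for smaller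
    \<open>k\<close> both equal \<open>k\<close>.\<close>
  have less: "k mod q < k mod (q - 1)" if "prime q" "odd q" "k mod q \<noteq> k mod (q - 1)" for q
  proof -
    have "q - 1 \<le> k" using that(3) by (cases "k < q - 1") auto
    then show ?thesis using D1_mod_less[OF k D1_odd[OF k]] that by blast
  qed
  \<comment> \<open>A nonzero residue of \<open>k + 1\<close> excludes wrap-around when 1 is
    subtracted.\<close>
  have mod: "k mod m = r" if "(k + 1) mod m = Suc r" for m r
    using that by (auto simp: mod_Suc split: if_splits)
  consider "i = 0" | "i = 1" | "i = 2" | t where "i = 3 + 2 * t" | t where "i = 4 + 2 * t"
  proof -
    have "i = 0 \<or> i = 1 \<or> i = 2 \<or> (\<exists>t. i = 3 + 2 * t) \<or> (\<exists>t. i = 4 + 2 * t)" by presburger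
    then show ?thesis using that by blast
  qed
  then show "k \<in> {1, 3, 15}"
  proof cases
    case 4
    \<comment> \<open>The residues 8 modulo 13 and 3 modulo 12 are in the wrong order for
      \<open>less\<close>; in the next case 224 modulo 241 and 15 modulo 240 are.\<close>
    have "k mod 13 = 8" using power_power_2_mod(1)[of t] mod[of 13 8] unfolding i 4 by simp
    moreover have "k mod 12 = 3" using power_power_2_mod(2)[of t] mod[of 12 3] unfolding i 4 by simp
    moreover have "prime (13 :: nat)" by simp
    ultimately show ?thesis using less[of 13] by simp
  next
    case 5
    have "k mod 241 = 224" using power_power_2_mod(3)[of t] mod[of 241 224] unfolding i 5 by simp
    moreover have "k mod 240 = 15" using power_power_2_mod(4)[of t] mod[of 240 15] unfolding i 5 by simp
    moreover have "prime (241 :: nat)" by simp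
    ultimately show ?thesis using less[of 241] by simp
  qed (use i in auto)
qed

end
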